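(* Let $(G_m)_{m\in\mathbb{Z}}$ be a generalized Fibonacci sequence and let $n\ge 0$ be an integer. Then $$\sum_{k=0}^n k\, G_k G_{n-k} = \frac{1}{10}\, n \left\{ \left[ (3n+5)G_0 - (n+1)G_1 \right] G_n - \left[ (n-1)G_0 - 2nG_1 \right] G_{n+1} \right\}.$$
   Context: A generalized Fibonacci sequence is a sequence $(G_m)_{m\in\mathbb{Z}}$ of complex numbers with $G_{m+2}=G_{m+1}+G_m$ for all integers $m$ (with arbitrary seed $G_0,G_1$). *)

theory Defs
  imports Complex_Main
begin

definition gen_fibonacci :: "(int \<Rightarrow> complex) \<Rightarrow> bool" where
  "gen_fibonacci G \<longleftrightarrow> (\<forall>m. G (m + 2) = G (m + 1) + G m)"

end

(* Reflecting k to n - k shows that the weighted sum is n/2 times the plain self-convolution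
   S n. The latter satisfies the Fibonacci recurrence with an inhomogeneous boundary term,
   so its closed form follows by two-step induction. *)
theory Submission
  imports Defs
begin

definition self_conv :: "(int \<Rightarrow> complex) \<Rightarrow> nat \<Rightarrow> complex" where
  "self_conv G n = (\<Sum>k=0..n. G (int k) * G (int n - int k))"

text \<open>For \<open>k \<le> n\<close> the recurrence is applied to the second factor only. The
  terms \<open>k = n + 1\<close> and \<open>k = n + 2\<close> are left over;
  \<open>G 1 - G 0\<close> arises because \<open>self_conv G (Suc n)\<close> already absorbs one
  \<open>G (int n + 1) * G 0\<close>.\<close>

lemma self_conv_rec:
  assumes "gen_fibonacci G"
  shows "self_conv G (Suc (Suc n)) = self_conv G (Suc n) + self_conv G n
    + G (int n + 1) * (G 1 - G 0) + G (int n + 2) * G 0"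
proof -
  \<comment> \<open>Holding for every \<open>k\<close>, this can rewrite under the sum; a negative
    \<open>int n - int k\<close> is harmless, as the recurrence covers all integers.\<close>
  have rec: "G (int n + 2 - int k) = G (int n + 1 - int k) + G (int n - int k)" for k
    using assms[unfolded gen_fibonacci_def, rule_format, of "int n - int k"]
    by (simp add: algebra_simps)
  have "(\<Sum>k=0..n. G (int k) * G (int n + 2 - int k)) =
      (\<Sum>k=0..n. G (int k) * G (int n + 1 - int k)) + self_conv G n"
    unfolding self_conv_def rec by (simp add: distrib_left sum.distrib)
  moreover have "self_conv G (Suc n) =
      (\<Sum>k=0..n. G (int k) * G (int n + 1 - int k)) + G (int n + 1) * G 0"
    unfolding self_conv_def by (simp add: add.commute)
  moreover have "self_conv G (Suc (Suc n)) =
      (\<Sum>k=0..n. G (int k) * G (int n + 2 - int k)) + G (int n + 1) * G 1 + G (int n + 2) * G 0"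
    unfolding self_conv_def by (simp add: add.commute)
  ultimately show ?thesis by (simp add: algebra_simps)
qed

lemma self_conv_closed_form:
  assumes "gen_fibonacci G"
  shows "5 * self_conv G n =
    ((3 * of_nat n + 5) * G 0 - (of_nat n + 1) * G 1) * G (int n)
    - ((of_nat n - 1) * G 0 - 2 * of_nat n * G 1) * G (int n + 1)"
proof (induction n rule: induct_nat_012)
  case 0
  show ?case by (simp add: self_conv_def algebra_simps)
next
  case 1
  have "G 2 = G 1 + G 0"
    using assms[unfolded gen_fibonacci_def, rule_format, of 0] by simp
  then show ?case by (simp add: self_conv_def algebra_simps)
next
  case (ge2 n)
  have 2: "G (int n + 2) = G (int n + 1) + G (int n)"
    using assms by (simp add: gen_fibonacci_def)
  have "G (int n + 3) = G (int n + 2) + G (int n + 1)"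
    using assms[unfolded gen_fibonacci_def, rule_format, of "int n + 1"]
    by (simp add: algebra_simps)
  \<comment> \<open>Once everything is expressed through \<open>G (int n)\<close> and
    \<open>G (int n + 1)\<close>, the induction step is a polynomial identity in these two values,
    \<open>G 0\<close>, \<open>G 1\<close> and \<open>n\<close>.\<close>
  then have 3: "G (int n + 3) = 2 * G (int n + 1) + G (int n)"
    using 2 by simp
  have idx: "int (Suc n) = int n + 1" "int n + 1 + 1 = int n + 2"
    "int (Suc (Suc n)) = int n + 2" "int n + 2 + 1 = int n + 3"
    by simp_all
  have "5 * self_conv G (Suc (Suc n)) = 5 * self_conv G (Suc n) + 5 * self_conv G n
      + 5 * (G (int n + 1) * (G 1 - G 0) + G (int n + 2) * G 0)"
    unfolding self_conv_rec[OF assms] by (simp add: algebra_simps)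
  then show ?case
    unfolding ge2.IH idx 2 3 by (simp add: algebra_simps)
qed

lemma two_weighted_self_conv:
  "2 * (\<Sum>k=0..n. of_nat k * G (int k) * G (int n - int k)) = of_nat n * self_conv G n"
proof -
  let ?f = "\<lambda>k. of_nat k * G (int k) * G (int n - int k)"
  have "(\<Sum>k=0..n. ?f k) = (\<Sum>k=0..n. ?f (n - k))"
    using sum.atLeastAtMost_rev[of ?f 0 n] by simp
  then have "2 * (\<Sum>k=0..n. ?f k) = (\<Sum>k=0..n. ?f k + ?f (n - k))"
    by (simp add: sum.distrib)
  also have "\<dots> = (\<Sum>k=0..n. of_nat n * (G (int k) * G (int n - int k)))"
    \<comment> \<open>As \<open>k \<le> n\<close> in the range, \<open>n - k\<close> is not
      truncated: the reflection swaps the two factors, and the weights \<open>k\<close> and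
      \<open>n - k\<close> add up to \<open>n\<close>.\<close>
    by (rule sum.cong) (auto simp: of_nat_diff algebra_simps)
  finally show ?thesis
    by (simp add: self_conv_def sum_distrib_left)
qed

theorem mainTheorem10:
  fixes G :: "int \<Rightarrow> complex" and n :: nat
  assumes "gen_fibonacci G"
  shows "(\<Sum>k=0..n. of_nat k * G (int k) * G (int n - int k)) =
    1 / 10 * of_nat n *
      (((3 * of_nat n + 5) * G 0 - (of_nat n + 1) * G 1) * G (int n)
       - ((of_nat n - 1) * G 0 - 2 * of_nat n * G 1) * G (int n + 1))"
  \<comment> \<open>Read backwards, the closed form turns the braces into
    \<open>5 * self_conv G n\<close>, so the factor 1/10 becomes the 1/2 of the reflection
    identity.\<close>
  unfolding self_conv_closed_form[OF assms, symmetric]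
  using two_weighted_self_conv[of G n] by (simp add: mult.commute[of _ 2])

end
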